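(* Let $(M;\vee,\wedge,\oplus,0)$ be a locally complete EMV-algebra with a square root $r$. (i) $M$ is divisible if and only if the square root on $M$ is strict (i.e. $M$ is a strict EMV-algebra). (ii) Any locally complete divisible EMV-algebra with a square root has a top element.
   Context: An EMV-algebra is an algebra $(M;\vee,\wedge,\oplus,0)$ of type $(2,2,2,0)$ such that: (E1) $(M;\vee,\wedge,0)$ is a distributive lattice with least element $0$; (E2) $(M;\oplus,0)$ is a commutative ordered monoid with neutral element $0$; (E3) writing $\mathcal I(M)=\{x\in M\mid x\oplus x=x\}$ (the idempotents), for each $a\in\mathcal I(M)$ and each $x\in[0,a]$ the element $\lambda_a(x)=\min\{z\in[0,a]\mid x\oplus z=a\}$ exists, and $([0,a];\oplus,\lambda_a,0,a)$ is an MV-algebra; (E4) for each $x\in M$ there is $a\in\mathcal I(M)$ with $x\le a$. A top element is not assumed. For $x,y\in M$, $x\odot y:=\lambda_a(\lambda_a(x)\oplus\lambda_a(y))$ for any $a\in\mathcal I(M)$ with $x,y\le a$ (this does not depend on $a$). A square root on $M$ is a map $s:M\to M$ such that (Sq1) $s(x)\odot s(x)=x$ for all $x\in M$; (Sq2) for all $x,y\in M$, $y\odot y\le x$ implies $y\le s(x)$. A square root is unique if it exists. For $b\in\mathcal I(M)$, $s_b:[0,b]\to[0,b]$, $s_b(x)=s(x)\wedge b$, is a square root on the MV-algebra $[0,b]$. An EMV-algebra $M$ with a square root $s$ (or the square root $s$ itself) is called strict if, for each $b\in\mathcal I(M)$ with $b\ge s(0)$, $s_b(0)=\lambda_b(s_b(0))$.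 $M$ is locally complete if for each $x\in M$ there is $a\in\mathcal I(M)$ with $x\le a$ such that the MV-algebra $([0,a];\oplus,\lambda_a,0,a)$ is complete (as a lattice). With $0.y=0$ and $n.y=(n-1).y\oplus y$, $M$ is divisible if for each $x\in M$ and each integer $n\ge1$ there is $y\in M$ with $n.y=x$ and $((n-1).y)\odot y=0$. *)

theory Defs
  imports "HOL-Algebra.Complete_Lattice"
begin

(* HOL-Algebra's infima and suprema of sets would shadow the type-class operations inf and sup. *)
hide_const (open) Lattice.inf Lattice.sup

locale mv_algebra =
  fixes C :: "'a set" and oplus :: "'a \<Rightarrow> 'a \<Rightarrow> 'a" and neg :: "'a \<Rightarrow> 'a" and zero one :: 'a
  assumes zero_closed: "zero \<in> C"
    and one_closed: "one \<in> C"
    and oplus_closed: "x \<in> C \<Longrightarrow> y \<in> C \<Longrightarrow> oplus x y \<in> C"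
    and neg_closed: "x \<in> C \<Longrightarrow> neg x \<in> C"
    and oplus_assoc: "x \<in> C \<Longrightarrow> y \<in> C \<Longrightarrow> z \<in> C \<Longrightarrow> oplus (oplus x y) z = oplus x (oplus y z)"
    and oplus_commute: "x \<in> C \<Longrightarrow> y \<in> C \<Longrightarrow> oplus x y = oplus y x"
    and oplus_zero: "x \<in> C \<Longrightarrow> oplus x zero = x"
    and oplus_one: "x \<in> C \<Longrightarrow> oplus x one = one"
    and neg_zero: "neg zero = one"
    and neg_neg: "x \<in> C \<Longrightarrow> neg (neg x) = x"
    and lukasiewicz: "x \<in> C \<Longrightarrow> y \<in> C \<Longrightarrow>
      oplus (neg (oplus (neg x) y)) y = oplus (neg (oplus (neg y) x)) x"

text \<open>An EMV-algebra \<open>(M; \<or>, \<and>, \<oplus>, 0)\<close> is a type of class \<open>emv_algebra\<close> below, with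
  \<open>\<or>\<close>, \<open>\<and>\<close>, \<open>\<oplus>\<close>, \<open>0\<close> being \<open>sup\<close>, \<open>inf\<close>, \<open>+\<close>, \<open>0\<close>. The following class contains (E1) and
  (E2).\<close>

class ordered_emv_base = distrib_lattice + ordered_comm_monoid_add +
  assumes zero_least: "0 \<le> x"
begin

definition idempotent :: "'a \<Rightarrow> bool" where
  "idempotent a \<longleftrightarrow> a + a = a"

definition lam :: "'a \<Rightarrow> 'a \<Rightarrow> 'a" where
  "lam a x = (LEAST z. z \<in> {0..a} \<and> x + z = a)"

end

class emv_algebra = ordered_emv_base +
  assumes lam_exists: "idempotent a \<Longrightarrow> x \<in> {0..a} \<Longrightarrow>
      \<exists>z \<in> {0..a}. x + z = a \<and> (\<forall>w \<in> {0..a}. x + w = a \<longrightarrow> z \<le> w)"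
    and interval_mv: "idempotent a \<Longrightarrow> mv_algebra {0..a} (+) (lam a) 0 a"
    and idempotent_above: "\<exists>a. idempotent a \<and> x \<le> a"

text \<open>The value does not depend on the choice of the idempotent \<open>a\<close>, and one exists because
  the sum of two idempotents is an idempotent above both.\<close>

definition odot :: "'a::emv_algebra \<Rightarrow> 'a \<Rightarrow> 'a" (infixl "\<odot>" 70) where
  "x \<odot> y = (let a = (SOME a. idempotent a \<and> x \<le> a \<and> y \<le> a)
            in lam a (lam a x + lam a y))"

definition square_root :: "('a::emv_algebra \<Rightarrow> 'a) \<Rightarrow> bool" where
  "square_root s \<longleftrightarrow> (\<forall>x. s x \<odot> s x = x) \<and> (\<forall>x y. y \<odot> y \<le> x \<longrightarrow> y \<le> s x)"

definition local_root :: "('a::emv_algebra \<Rightarrow> 'a) \<Rightarrow> 'a \<Rightarrow> 'a \<Rightarrow> 'a" where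
  "local_root s b x = inf (s x) b"

definition strict_square_root :: "('a::emv_algebra \<Rightarrow> 'a) \<Rightarrow> bool" where
  "strict_square_root s \<longleftrightarrow> square_root s \<and>
     (\<forall>b. idempotent b \<and> s 0 \<le> b \<longrightarrow> local_root s b 0 = lam b (local_root s b 0))"

lemma interval_mv_order:
  fixes a x y :: "'a::emv_algebra"
  assumes a: "idempotent a" and x: "x \<in> {0..a}" and y: "y \<in> {0..a}"
  shows "lam a x + y = a \<longleftrightarrow> x \<le> y"
proof -
  interpret mv_algebra "{0..a}" "(+)" "lam a" 0 a
    using a by (rule interval_mv)
  have least: "u + lam a u = a \<and> (\<forall>w \<in> {0..a}. u + w = a \<longrightarrow> lam a u \<le> w)"
    if u: "u \<in> {0..a}" for u
  proof -
    obtain z where z: "z \<in> {0..a}" "u + z = a" "\<forall>w \<in> {0..a}. u + w = a \<longrightarrow> z \<le> w"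
      using lam_exists[OF a u] by blast
    then have "lam a u = z"
      unfolding lam_def by (intro Least_equality) auto
    with z show ?thesis by simp
  qed
  show ?thesis
  proof
    assume "lam a x + y = a"
    then have "lam a (lam a x) \<le> y"
      using least[OF neg_closed[OF x]] y by blast
    then show "x \<le> y" by (simp only: neg_neg[OF x])
  next
    assume "x \<le> y"
    then have "x + lam a x \<le> y + lam a x" by (rule add_right_mono)
    then have "a \<le> y + lam a x" using least[OF x] by simp
    moreover have "y + lam a x \<le> a"
      using oplus_closed[OF y neg_closed[OF x]] by simp
    ultimately show "lam a x + y = a" by (simp add: add.commute)
  qed
qed

text \<open>By the preceding lemma, the lattice order of the MV-algebra on \<open>{0..a}\<close> is the restriction
  of the order of the EMV-algebra.\<close>

definition locally_complete :: "'a::emv_algebra itself \<Rightarrow> bool" where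
  "locally_complete _ \<longleftrightarrow> (\<forall>x::'a. \<exists>a. idempotent a \<and> x \<le> a \<and>
     Complete_Lattice.complete_lattice \<lparr>carrier = {0..a}, eq = (=), le = (\<le>)\<rparr>)"

primrec nmult :: "nat \<Rightarrow> 'a::emv_algebra \<Rightarrow> 'a" where
  "nmult 0 y = 0"
| "nmult (Suc n) y = nmult n y + y"

definition divisible :: "'a::emv_algebra itself \<Rightarrow> bool" where
  "divisible _ \<longleftrightarrow> (\<forall>x::'a. \<forall>n\<ge>1. \<exists>y. nmult n y = x \<and> nmult (n - 1) y \<odot> y = 0)"

end

theory Submission
  imports Defs
begin

text \<open>Testing divisibility by two at an idempotent \<open>b \<ge> r 0\<close> gives a self-complementary
  element of \<open>[0,b]\<close>, which is forced to be \<open>r 0\<close>; hence \<open>r\<close> is strict. Conversely strictness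
  says that \<open>r 0 + r 0 = b\<close> for every idempotent \<open>b \<ge> r 0\<close>, so there is only one such \<open>b\<close> and
  it is the top element. In the complete MV-algebra \<open>[0,b]\<close> take a minimal \<open>y\<close> with
  \<open>x \<le> n.y\<close> (Zorn; addition preserves infima since it is residuated). If \<open>y\<close> exceeded
  \<open>x \<ominus> (n-1).y\<close> by some \<open>d \<noteq> 0\<close>, then subtracting from \<open>y\<close> a nonzero \<open>e\<close> with \<open>n.e \<le> d\<close>,
  obtained by repeated halving with \<open>r x \<ominus> r 0\<close>, would contradict minimality. Thus
  \<open>y = x \<ominus> (n-1).y\<close>, and this \<open>y\<close> is the required \<open>n\<close>-th part of \<open>x\<close>.\<close>

section \<open>Positivity and sums of idempotents\<close>

declare zero_least [simp]

lemma le_plus1 [simp]: "x \<le> x + (y::'a::emv_algebra)"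
  using add_left_mono[OF zero_least[of y], of x] by simp

lemma le_plus2 [simp]: "x \<le> y + (x::'a::emv_algebra)"
  by (metis add.commute le_plus1)

lemma le_zero [simp]: "x \<le> 0 \<longleftrightarrow> x = (0::'a::emv_algebra)"
  by (auto intro: antisym)

lemma idempotent_plus:
  fixes a b :: "'a::emv_algebra"
  assumes "idempotent a" "idempotent b"
  shows "idempotent (a + b)"
proof -
  have "(a + b) + (a + b) = (a + a) + (b + b)" by (simp only: ac_simps)
  then show ?thesis using assms by (simp add: idempotent_def)
qed

section \<open>Subtraction and meets in the MV-algebra \<open>[0,b]\<close>\<close>

locale emv_interval =
  fixes b :: "'a::emv_algebra"
  assumes idem: "idempotent b"
begin

sublocale mv: mv_algebra "{0..b}" "(+)" "lam b" 0 b
  using idem by (rule interval_mv)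

text \<open>This is the truncated difference of MV-algebras,
  \<open>x \<odot> lam b y\<close>.\<close>

definition minus :: "'a \<Rightarrow> 'a \<Rightarrow> 'a" (infixl "\<ominus>" 65) where
  "x \<ominus> y = lam b (lam b x + y)"

lemma plus_le: "x \<le> b \<Longrightarrow> y \<le> b \<Longrightarrow> x + y \<le> b"
  using mv.oplus_closed[of x y] by simp

lemma lam_le: "x \<le> b \<Longrightarrow> lam b x \<le> b"
  using mv.neg_closed[of x] by simp

lemma lam_lam: "x \<le> b \<Longrightarrow> lam b (lam b x) = x"
  using mv.neg_neg[of x] by simp

lemma lam_plus_eq_iff: "x \<le> b \<Longrightarrow> y \<le> b \<Longrightarrow> lam b x + y = b \<longleftrightarrow> x \<le> y"
  using interval_mv_order[OF idem, of x y] by simp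

lemma plus_lam: "x \<le> b \<Longrightarrow> x + lam b x = b"
  using lam_plus_eq_iff[of x x] by (simp add: add.commute)

lemma lam_antimono: "x \<le> y \<Longrightarrow> y \<le> b \<Longrightarrow> lam b y \<le> lam b x"
  by (metis add.commute lam_plus_eq_iff lam_le lam_lam order_trans)

lemma minus_le_top: "x \<le> b \<Longrightarrow> y \<le> b \<Longrightarrow> x \<ominus> y \<le> b"
  by (simp add: minus_def lam_le plus_le)

lemma lam_minus: "x \<le> b \<Longrightarrow> y \<le> b \<Longrightarrow> lam b (x \<ominus> y) = lam b x + y"
  by (simp add: minus_def lam_lam lam_le plus_le)

text \<open>Both sides say that \<open>lam b x + y + z = b\<close>. So \<open>\<ominus>\<close> is
  the residual of addition.\<close>

lemma minus_le_iff:
  assumes "x \<le> b" "y \<le> b" "z \<le> b"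
  shows "x \<ominus> y \<le> z \<longleftrightarrow> x \<le> y + z"
  using lam_plus_eq_iff[of "x \<ominus> y" z] lam_plus_eq_iff[of x "y + z"] assms
  by (simp add: lam_minus minus_le_top plus_le add.assoc)

lemma le_plus_minus: "x \<le> b \<Longrightarrow> y \<le> b \<Longrightarrow> x \<le> y + (x \<ominus> y)"
  using minus_le_iff[of x y "x \<ominus> y"] by (simp add: minus_le_top)

lemma minus_le: "x \<le> b \<Longrightarrow> y \<le> b \<Longrightarrow> x \<ominus> y \<le> x"
  by (simp add: minus_le_iff)

lemma minus_self: "x \<le> b \<Longrightarrow> x \<ominus> x = 0"
  using minus_le_iff[of x x 0] by simp

lemma minus_mono:
  assumes "x \<le> x'" "y' \<le> y" "x' \<le> b" "y \<le> b"
  shows "x \<ominus> y \<le> x' \<ominus> y'"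
proof -
  have "y' \<le> b" "x \<le> b" using assms by auto
  moreover have "x \<le> y + (x' \<ominus> y')"
    using le_plus_minus[of x' y'] assms calculation
    by (meson add_right_mono order_trans)
  ultimately show ?thesis
    using assms minus_le_iff[of x y "x' \<ominus> y'"] minus_le_top[of x' y'] by simp
qed

text \<open>By the Lukasiewicz axiom \<open>y + (x \<ominus> y)\<close> is symmetric in
  \<open>x\<close> and \<open>y\<close>, and here \<open>y \<ominus> x = 0\<close>.\<close>

lemma plus_minus_le:
  assumes "y \<le> x" "x \<le> b"
  shows "y + (x \<ominus> y) = x"
proof -
  have y: "y \<le> b" using assms by simp
  have "y \<ominus> x = 0"
    using minus_le_iff[of y x 0] assms y by simp
  then show ?thesis
    using mv.lukasiewicz[of x y] assms y by (simp add: minus_def add.commute)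
qed

text \<open>The condition on \<open>y\<close> excludes truncation of the sum at \<open>b\<close>;
  complementing reduces the claim to \<open>plus_minus_le\<close> for
  \<open>y \<le> lam b x\<close>.\<close>

lemma plus_minus_cancel:
  assumes "x \<le> b" "y \<le> lam b x"
  shows "(x + y) \<ominus> y = x"
proof -
  have y: "y \<le> b" using assms lam_le by (meson order_trans)
  have "lam b (x + y) = lam b x \<ominus> y"
    by (simp add: minus_def lam_lam assms)
  then have "(x + y) \<ominus> y = lam b (y + (lam b x \<ominus> y))"
    by (simp add: minus_def add.commute)
  then show ?thesis
    using plus_minus_le[of y "lam b x"] assms by (simp add: lam_le lam_lam)
qed

lemma minus_le_lam:
  assumes "x \<le> b" "y \<le> b"
  shows "x \<ominus> y \<le> lam b y"
  unfolding minus_def using assms by (intro lam_antimono plus_le lam_le) auto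

text \<open>Adding \<open>x\<close> is right adjoint to subtracting \<open>x\<close>, hence
  preserves meets.\<close>

lemma plus_inf_distrib:
  assumes "x \<le> b" "y \<le> b" "z \<le> b"
  shows "x + inf y z = inf (x + y) (x + z)"
proof (rule antisym)
  show "x + inf y z \<le> inf (x + y) (x + z)"
    by (simp add: add_left_mono)
  let ?w = "inf (x + y) (x + z)"
  have w: "?w \<le> b" using assms by (meson inf.coboundedI1 plus_le)
  have "?w \<ominus> x \<le> inf y z"
    using assms w by (simp add: minus_le_iff)
  then show "?w \<le> x + inf y z"
    using assms w minus_le_iff[of ?w x "inf y z"] by (simp add: le_infI1)
qed

text \<open>Adding \<open>?w\<close> to \<open>?m\<close> stays below both \<open>x\<close> and
  \<open>u\<close>, so below \<open>?m\<close>; no truncation occurs, and cancelling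
  \<open>?m\<close> leaves \<open>?w = 0\<close>.\<close>

lemma inf_minus_minus:
  assumes "x \<le> b" "u \<le> b"
  shows "inf (u \<ominus> x) (x \<ominus> u) = 0"
proof -
  let ?m = "inf x u" and ?w = "inf (u \<ominus> x) (x \<ominus> u)"
  have m: "?m \<le> b" using assms by (simp add: le_infI1)
  have w: "?w \<le> b" using assms by (simp add: le_infI1 minus_le_top)
  have "?m + ?w \<le> x"
  proof -
    have "?w \<le> x \<ominus> ?m"
      using minus_mono[of x x ?m u] assms by (simp add: le_infI2)
    then show ?thesis
      using plus_minus_le[of ?m x] assms by (metis add_left_mono inf_le1)
  qed
  moreover have "?m + ?w \<le> u"
  proof -
    have "?w \<le> u \<ominus> ?m"
      using minus_mono[of u u ?m x] assms by (simp add: le_infI1)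
    then show ?thesis
      using plus_minus_le[of ?m u] assms by (metis add_left_mono inf_le2)
  qed
  ultimately have le: "?w + ?m \<le> ?m" by (simp add: add.commute)
  have "?w \<le> lam b u" using minus_le_lam[OF assms] by (simp add: le_infI2)
  also have "\<dots> \<le> lam b ?m" using assms by (intro lam_antimono) auto
  finally have "?m \<le> lam b ?w"
    using lam_antimono[of ?w "lam b ?m"] m by (simp add: lam_lam lam_le)
  then have "?w = (?w + ?m) \<ominus> ?m" using w by (simp add: plus_minus_cancel)
  also have "\<dots> \<le> ?m \<ominus> ?m" using le m by (intro minus_mono) auto
  finally show ?thesis using m by (simp add: minus_self)
qed

text \<open>The remainder \<open>z \<ominus> u\<close> lies below both \<open>z\<close> and
  \<open>y\<close>, so it vanishes.\<close>

lemma le_plus_disjoint: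
  assumes "z \<le> b" "u \<le> b" "y \<le> b" "z \<le> u + y" "inf z y = 0"
  shows "z \<le> u"
proof -
  have "z \<ominus> u \<le> inf z y"
    using minus_le[of z u] minus_le_iff[of z u y] assms(1-4) by simp
  then have "z \<ominus> u \<le> 0" using assms(5) by simp
  then show ?thesis using minus_le_iff[of z u 0] assms by simp
qed

section \<open>Independence of \<open>\<odot>\<close> from the enclosing idempotent\<close>

lemma lam_below:
  assumes a: "idempotent a" "a \<le> b" and x: "x \<le> a"
  shows "lam a x = inf (lam b x) a"
proof -
  interpret A: emv_interval a by unfold_locales (rule a)
  have xb: "x \<le> b" using a x by simp
  have xa: "x + a = a"
    using A.plus_le[of x a] x by (intro antisym) auto
  let ?w = "inf (lam b x) a"
  have wb: "?w \<le> b" using a by (simp add: le_infI2)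
  have "x + ?w = a"
    using plus_inf_distrib[of x "lam b x" a] a xa xb by (simp add: lam_le plus_lam inf_absorb2)
  then have 1: "lam a x \<le> ?w"
    using A.lam_plus_eq_iff[of "lam a x" ?w] x by (simp add: A.lam_le A.lam_lam)
  \<comment> \<open>The missing inequality \<open>?w \<le> lam a x\<close> amounts to
    \<open>?v = b\<close>, which follows once \<open>?v\<close> is above
    \<open>a + lam b a\<close>.\<close>
  let ?v = "lam b ?w + lam a x"
  have lb: "lam a x \<le> b" using A.lam_le[OF x] a by simp
  have v: "?v \<le> b" using wb lb by (simp add: plus_le lam_le)
  have "x \<le> lam b ?w"
    using lam_antimono[of ?w "lam b x"] xb by (simp add: lam_lam lam_le)
  then have va: "a \<le> ?v"
    using A.plus_lam[OF x] by (metis add_right_mono)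
  have "lam b a \<le> lam b ?w" using a by (intro lam_antimono) auto
  then have "lam b a \<le> ?v" by (meson le_plus1 order_trans)
  \<comment> \<open>Idempotence enters here: \<open>lam b a \<ominus> a = lam b (a + a)\<close>.
    Hence \<open>lam b a\<close> still fits into \<open>?v\<close> after \<open>a\<close> is
    removed.\<close>
  moreover have "lam b a = lam b a \<ominus> a"
    using a by (simp add: minus_def lam_lam idempotent_def)
  ultimately have "lam b a \<le> ?v \<ominus> a"
    using minus_mono[of "lam b a" ?v a a] a v by simp
  then have "a + lam b a \<le> ?v"
    using plus_minus_le[OF va v] by (metis add_left_mono)
  then have "?v = b" using v a by (simp add: plus_lam)
  then have "?w \<le> lam a x"
    using lam_plus_eq_iff wb lb by blast
  with 1 show ?thesis by (rule antisym)
qed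

lemma product_le_iff:
  assumes "x \<le> b" "y \<le> b" "z \<le> b"
  shows "lam b (lam b x + lam b y) \<le> z \<longleftrightarrow> y \<le> lam b x + z"
proof -
  have "lam b (lam b x + lam b y) = y \<ominus> lam b x"
    by (simp add: minus_def add.commute)
  then show ?thesis using assms by (simp add: minus_le_iff lam_le)
qed

text \<open>Both products lie in \<open>[0,a]\<close> and have the same upper bounds there: by
  adjunction these are governed by \<open>lam a x + z\<close>, which is \<open>lam b x + z\<close>
  cut off at \<open>a\<close>.\<close>

lemma product_below:
  assumes a: "idempotent a" "a \<le> b" and x: "x \<le> a" and y: "y \<le> a"
  shows "lam a (lam a x + lam a y) = lam b (lam b x + lam b y)" (is "?pa = ?pb")
proof -
  interpret A: emv_interval a by unfold_locales (rule a)
  have xb: "x \<le> b" and yb: "y \<le> b" using a x y by auto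
  have "?pb \<le> y"
    using xb yb by (simp add: product_le_iff)
  then have pb: "?pb \<le> a" using y by simp
  have pa: "?pa \<le> a" using x y by (intro A.lam_le A.plus_le)
  have "?pa \<le> z \<longleftrightarrow> ?pb \<le> z" if z: "z \<le> a" for z
  proof -
    have zb: "z \<le> b" using z a by simp
    have "z + a = a" using A.plus_le[of z a] z by (intro antisym) auto
    then have "lam a x + z = inf (lam b x + z) a"
      using plus_inf_distrib[of z "lam b x" a] a xb zb lam_below[OF a x]
      by (simp add: add.commute lam_le)
    then show ?thesis
      using A.product_le_iff[OF x y z] product_le_iff[OF xb yb zb] y by simp
  qed
  then show ?thesis using pa pb by (meson antisym order_refl)
qed

lemma odot_eq:
  assumes "x \<le> b" "y \<le> b"
  shows "x \<odot> y = lam b (lam b x + lam b y)"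
proof -
  define a where "a = (SOME a. idempotent a \<and> x \<le> a \<and> y \<le> a)"
  have a: "idempotent a \<and> x \<le> a \<and> y \<le> a"
    unfolding a_def by (rule someI[of _ b]) (use assms idem in simp)
  \<comment> \<open>The chosen \<open>a\<close> and the given \<open>b\<close> need not be
    comparable, so both are compared with an idempotent above them.\<close>
  interpret C: emv_interval "a + b"
    by unfold_locales (simp add: a idem idempotent_plus)
  have "x \<odot> y = lam a (lam a x + lam a y)"
    by (simp add: odot_def a_def Let_def)
  also have "\<dots> = lam b (lam b x + lam b y)"
    using C.product_below[of a x y] C.product_below[of b x y] a assms idem by simp
  finally show ?thesis .
qed

lemma odot_eq_0_iff:
  assumes "x \<le> b" "y \<le> b"
  shows "x \<odot> y = 0 \<longleftrightarrow> y \<le> lam b x"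
  using product_le_iff[of x y 0] odot_eq[OF assms] assms by simp

lemma half_of_top:
  assumes "y + y = b" "y \<odot> y = 0"
  shows "y = lam b y"
proof (rule antisym)
  have y: "y \<le> b" using assms(1) le_plus1 by metis
  show "y \<le> lam b y" using odot_eq_0_iff[OF y y] assms(2) by simp
  show "lam b y \<le> y"
    using lam_plus_eq_iff[of "lam b y" y] y assms(1) by (simp add: lam_le lam_lam)
qed

end

section \<open>From divisibility to strictness\<close>

lemma divisible_imp_strict:
  fixes r :: "'a::emv_algebra \<Rightarrow> 'a"
  assumes div: "divisible TYPE('a)" and r: "square_root r"
  shows "strict_square_root r"
  unfolding strict_square_root_def
proof (intro conjI allI impI r)
  fix b :: 'a
  assume b: "idempotent b \<and> r 0 \<le> b"
  interpret emv_interval b by unfold_locales (use b in simp)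
  obtain y where y: "nmult 2 y = b" "nmult (2 - 1) y \<odot> y = 0"
    using div unfolding divisible_def by (meson one_le_numeral)
  then have y2: "y + y = b" "y \<odot> y = 0"
    by (simp_all add: numeral_2_eq_2)
  then have "y \<le> r 0" using r unfolding square_root_def by simp
  \<comment> \<open>Complementation reverses \<open>y \<le> r 0\<close>, which closes the cycle
    \<open>r 0 \<le> lam b (r 0) \<le> lam b y = y \<le> r 0\<close>.\<close>
  have "r 0 \<odot> r 0 = 0" using r unfolding square_root_def by simp
  then have "r 0 \<le> lam b (r 0)" using b by (simp add: odot_eq_0_iff)
  also have "\<dots> \<le> lam b y" using \<open>y \<le> r 0\<close> b by (simp add: lam_antimono)
  also have "\<dots> = y" using half_of_top[OF y2] by simp
  finally have "r 0 = y" using \<open>y \<le> r 0\<close> by simp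
  then show "local_root r b 0 = lam b (local_root r b 0)"
    using half_of_top[OF y2] b by (simp add: local_root_def inf_absorb1)
qed

section \<open>From strictness to a top element\<close>

lemma strict_imp_top:
  fixes r :: "'a::emv_algebra \<Rightarrow> 'a"
  assumes "strict_square_root r"
  obtains t :: 'a where "idempotent t" "\<And>x. x \<le> t" "lam t (r 0) = r 0"
proof -
  have half: "r 0 = lam b (r 0)" if "idempotent b" "r 0 \<le> b" for b
    using assms that unfolding strict_square_root_def local_root_def
    by (metis inf_absorb1)
  have sum: "r 0 + r 0 = b" if "idempotent b" "r 0 \<le> b" for b
  proof -
    interpret emv_interval b by unfold_locales (rule that)
    show ?thesis using plus_lam[of "r 0"] half that by simp
  qed
  obtain t where t: "idempotent t" "r 0 \<le> t" using idempotent_above by blast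
  have "x \<le> t" for x
  proof -
    obtain c where c: "idempotent c" "x \<le> c" using idempotent_above by blast
    have "r 0 \<le> c + t" using t by (meson le_plus2 order_trans)
    then have "c + t = t"
      using sum[of "c + t"] sum[of t] t c idempotent_plus by metis
    then show ?thesis using c by (metis le_plus1 order_trans)
  qed
  then show ?thesis using that t half by metis
qed

section \<open>Multiples, halving and division below a top element\<close>

lemma nmult_mono: "x \<le> y \<Longrightarrow> nmult n x \<le> nmult n (y::'a::emv_algebra)"
  by (induction n) (auto intro: add_mono)

lemma nmult_plus: "nmult n (x + y) = nmult n x + nmult n (y::'a::emv_algebra)"
  by (induction n) (simp_all add: ac_simps)

lemma nmult_add: "nmult (m + n) x = nmult m x + nmult n (x::'a::emv_algebra)"
  by (induction n) (simp_all add: ac_simps)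

locale emv_top = emv_interval +
  assumes top: "\<And>x. x \<le> b"
begin

text \<open>The half is \<open>e = r d \<ominus> r 0\<close>. Since \<open>r 0\<close> is its own
  complement, \<open>lam b (r d) = t\<close> and \<open>r d = e + e + t\<close>, so
  \<open>d = r d \<odot> r d = r d \<ominus> t = e + e\<close>.\<close>

lemma exists_half:
  assumes r: "square_root r" and h: "lam b (r 0) = r 0" and "d \<noteq> 0"
  shows "\<exists>e. e \<noteq> 0 \<and> e \<le> d \<ominus> e \<and> e + e = d"
proof -
  let ?h = "r 0" and ?s = "r d"
  define e where "e = ?s \<ominus> ?h"
  define t where "t = ?h \<ominus> e"
  have sq: "r x \<odot> r x = x" and sq_le: "y \<odot> y \<le> x \<Longrightarrow> y \<le> r x" for x y
    using r unfolding square_root_def by auto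
  have "?h \<le> ?s" using sq_le[of ?h d] sq[of 0] by simp
  have "e \<le> ?h" unfolding e_def using minus_le_lam[OF top top, of ?s ?h] h by simp
  have s: "?s = ?h + e"
    unfolding e_def using plus_minus_le[OF \<open>?h \<le> ?s\<close> top] by simp
  have lam_s: "lam b ?s = t"
    unfolding t_def minus_def s h ..
  have h_eq: "?h = e + t"
    unfolding t_def using plus_minus_le[OF \<open>e \<le> ?h\<close> top] by simp
  \<comment> \<open>This bound ensures that \<open>t\<close> can be cancelled from
    \<open>(e + e) + t\<close> without truncation.\<close>
  have "e + e \<le> ?s" unfolding s using \<open>e \<le> ?h\<close> by (rule add_right_mono)
  then have "e + e \<le> lam b t" using lam_s lam_lam[OF top, of ?s] by simp
  then have "t \<le> lam b (e + e)"
    using lam_antimono[OF _ top, of "e + e" "lam b t"] lam_lam[OF top, of t] by simp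
  then have "((e + e) + t) \<ominus> t = e + e" by (rule plus_minus_cancel[OF top])
  moreover have "?s = (e + e) + t" unfolding s h_eq by (simp add: ac_simps)
  moreover have "d = ?s \<ominus> t"
    using sq[of d] lam_s by (simp add: odot_eq[OF top top] minus_def)
  ultimately have d: "d = e + e" by simp
  have "lam b ?h \<le> lam b e" using \<open>e \<le> ?h\<close> top by (rule lam_antimono)
  then have "e \<le> lam b e" using \<open>e \<le> ?h\<close> h by simp
  then have "e \<le> d \<ominus> e" unfolding d by (simp add: plus_minus_cancel[OF top])
  then show ?thesis using d \<open>d \<noteq> 0\<close> by (intro exI[of _ e]) auto
qed

text \<open>The bound by \<open>d \<ominus> e\<close> makes \<open>n + 1\<close> copies of
  \<open>e\<close> fit into \<open>d\<close> without truncation. Halving \<open>e\<close> doubles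
  the number of copies.\<close>

lemma exists_small:
  assumes r: "square_root r" and h: "lam b (r 0) = r 0" and d: "d \<noteq> 0"
  shows "\<exists>e. e \<noteq> 0 \<and> e \<le> d \<and> nmult n e \<le> d \<ominus> e"
proof (induction n)
  case 0
  show ?case using d by auto
next
  case (Suc n)
  then obtain e where e: "e \<noteq> 0" "e \<le> d" "nmult n e \<le> d \<ominus> e" by blast
  \<comment> \<open>Doubling gives \<open>n + 1 \<le> n + n\<close> only for
    \<open>n \<ge> 1\<close>, so \<open>n = 0\<close> is settled by a single halving of
    \<open>d\<close>.\<close>
  show ?case
  proof (cases n)
    case 0
    then show ?thesis using exists_half[OF r h d] minus_le[OF top top] order_trans by fastforce
  next
    case (Suc m)
    obtain f where f: "f \<noteq> 0" "f + f = e" using exists_half[OF r h e(1)] by blast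
    have "nmult (Suc n) f \<le> nmult (n + n) f"
      unfolding Suc using nmult_add[of "Suc (Suc m)" m f] by simp
    also have "\<dots> = nmult n e" using f by (simp add: nmult_add nmult_plus[symmetric])
    also have "\<dots> \<le> d \<ominus> e" by (rule e)
    also have "\<dots> \<le> d \<ominus> f" using f by (intro minus_mono top) auto
    finally show ?thesis using f e le_plus1[of f f] by (metis order_trans)
  qed
qed

text \<open>With \<open>y\<close> in the role of the infimum of \<open>C\<close>, the
  \<open>n\<close> copies of \<open>c\<close> are replaced by \<open>y\<close> one at a time.
  Residuation isolates one copy, and the resulting bound holds for every member of the chain, hence
  for \<open>y\<close>.\<close>

lemma le_nmult_Inf_chain:
  fixes x :: 'a
  assumes chain: "\<And>c c'. c \<in> C \<Longrightarrow> c' \<in> C \<Longrightarrow> c \<le> c' \<or> c' \<le> c"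
    and ne: "C \<noteq> {}" and C: "\<And>c. c \<in> C \<Longrightarrow> x \<le> nmult n c"
    and y: "\<And>z. (\<And>c. c \<in> C \<Longrightarrow> z \<le> c) \<Longrightarrow> z \<le> y"
  shows "x \<le> nmult n y"
proof -
  have "\<forall>c\<in>C. x \<le> nmult m y + nmult (n - m) c" if "m \<le> n" for m
    using that
  proof (induction m)
    case 0
    then show ?case using C by simp
  next
    case (Suc m)
    then obtain k where k: "n - m = Suc k" "n - Suc m = k"
      by (metis Suc_diff_Suc Suc_le_lessD)
    show ?case
    proof
      fix c assume c: "c \<in> C"
      let ?u = "nmult m y + nmult k c"
      have "x \<ominus> ?u \<le> c'" if c': "c' \<in> C" for c'
      proof -
        \<comment> \<open>The smaller of \<open>c\<close> and \<open>c'\<close> is again in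
          \<open>C\<close>, so the induction hypothesis applies to it; monotonicity then separates
          the last copy from the others.\<close>
        let ?l = "inf c c'"
        have "?l \<in> C" using chain[OF c c'] c c' by (auto simp: inf_absorb1 inf_absorb2)
        then have "x \<le> nmult m y + (nmult k ?l + ?l)" using Suc k by simp
        also have "\<dots> \<le> nmult m y + (nmult k c + c')"
          by (intro add_mono nmult_mono) auto
        finally show ?thesis by (simp add: minus_le_iff top add.assoc)
      qed
      then have "x \<ominus> ?u \<le> y" by (rule y)
      then have "x \<le> ?u + y" by (simp add: minus_le_iff top)
      then show "x \<le> nmult (Suc m) y + nmult (n - Suc m) c"
        using k by (simp add: ac_simps)
    qed
  qed
  from this[of n] ne show ?thesis by auto
qed

lemma minimal_nmult:
  fixes x :: 'a
  assumes complete: "Complete_Lattice.complete_lattice \<lparr>carrier = {0..b}, eq = (=), le = (\<le>)\<rparr>"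
    and "x \<le> nmult n x"
  obtains y where "x \<le> nmult n y" "\<And>z. x \<le> nmult n z \<Longrightarrow> z \<le> y \<Longrightarrow> z = y"
proof -
  let ?S = "{z. x \<le> nmult n z}"
  interpret L: Complete_Lattice.complete_lattice "\<lparr>carrier = {0..b}, eq = (=), le = (\<le>)\<rparr>"
    by (rule complete)
  \<comment> \<open>Zorn's lemma is applied to the reversed order, so maximal means minimal.\<close>
  have "\<exists>m\<in>?S. \<forall>a\<in>?S. (\<lambda>u v. v \<le> u) m a \<longrightarrow> a = m"
  proof (rule predicate_Zorn)
    show "partial_order_on ?S (relation_of (\<lambda>u v. v \<le> u) ?S)"
      by (rule partial_order_on_relation_ofI) auto
  next
    fix C assume "C \<in> Chains (relation_of (\<lambda>u v. v \<le> u) ?S)"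
    then have C: "C \<subseteq> ?S" "\<And>c c'. c \<in> C \<Longrightarrow> c' \<in> C \<Longrightarrow> c \<le> c' \<or> c' \<le> c"
      unfolding Chains_def relation_of_def by auto
    show "\<exists>u\<in>?S. \<forall>a\<in>C. u \<le> a"
    proof (cases "C = {}")
      case True
      then show ?thesis using assms(2) by auto
    next
      case False
      have "C \<subseteq> {0..b}" using top by auto
      then obtain y where y: "greatest \<lparr>carrier = {0..b}, eq = (=), le = (\<le>)\<rparr> y
          (Lower \<lparr>carrier = {0..b}, eq = (=), le = (\<le>)\<rparr> C)"
        using L.inf_exists[of C] by auto
      then have lower: "y \<le> c" if "c \<in> C" for c
        using that top by (auto simp: greatest_def Lower_def)
      have greatest: "z \<le> y" if "\<And>c. c \<in> C \<Longrightarrow> z \<le> c" for z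
        using y that top by (simp add: greatest_def Lower_def)
      have "x \<le> nmult n y"
        by (rule le_nmult_Inf_chain[OF C(2) False _ greatest]) (use C(1) in auto)
      with lower show ?thesis by blast
    qed
  qed
  then show ?thesis using that by auto
qed

lemma divisor:
  fixes x :: 'a
  assumes r: "square_root r" and h: "lam b (r 0) = r 0"
    and complete: "Complete_Lattice.complete_lattice \<lparr>carrier = {0..b}, eq = (=), le = (\<le>)\<rparr>"
  shows "\<exists>y. nmult (Suc n) y = x \<and> nmult n y \<odot> y = 0"
proof -
  obtain y where y: "x \<le> nmult (Suc n) y"
    and min: "\<And>z. x \<le> nmult (Suc n) z \<Longrightarrow> z \<le> y \<Longrightarrow> z = y"
    by (rule minimal_nmult[OF complete, of x "Suc n"]) auto
  define u where "u = nmult n y"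
  \<comment> \<open>The excess of \<open>y\<close> over the amount that \<open>u\<close> leaves
    uncovered in \<open>x\<close>.\<close>
  define d where "d = y \<ominus> (x \<ominus> u)"
  have le: "x \<ominus> u \<le> y" using y by (simp add: u_def minus_le_iff top)
  have "d = 0"
  proof (rule ccontr)
    assume "d \<noteq> 0"
    then obtain e where e: "e \<noteq> 0" "e \<le> d" "nmult n e \<le> d \<ominus> e"
      using exists_small[OF r h] by blast
    \<comment> \<open>Passing from \<open>y\<close> to \<open>?y\<close> costs at most
      \<open>nmult n e\<close> in the first \<open>n\<close> copies. The last copy makes up for it:
      it still exceeds \<open>x \<ominus> u\<close> by \<open>d \<ominus> e\<close>.\<close>
    let ?y = "y \<ominus> e"
    have u_le: "u \<le> nmult n ?y + nmult n e"
      using nmult_mono[OF le_plus_minus[OF top top], of n y e]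
      by (simp add: u_def nmult_plus add.commute)
    have "x \<ominus> u = (x \<ominus> u + d) \<ominus> d"
      unfolding d_def by (rule plus_minus_cancel[OF top minus_le_lam[OF top top], symmetric])
    also have "\<dots> = y \<ominus> d" unfolding d_def using plus_minus_le[OF le top] by simp
    also have "\<dots> \<le> ?y" using e by (intro minus_mono top) auto
    finally have v_le: "x \<ominus> u \<le> ?y" .
    have "d \<ominus> e = ?y \<ominus> (x \<ominus> u)"
      unfolding d_def minus_def[of _ e] minus_def[of "lam b (lam b y + e)"]
      by (simp add: lam_minus lam_lam top ac_simps)
    then have "x \<ominus> u + nmult n e \<le> ?y"
      using e plus_minus_le[OF v_le top] by (metis add_left_mono)
    then have "nmult n ?y + (x \<ominus> u + nmult n e) \<le> nmult (Suc n) ?y"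
      by (simp add: add_left_mono)
    moreover have "x \<le> u + (x \<ominus> u)" by (rule le_plus_minus[OF top top])
    moreover have "\<dots> \<le> nmult n ?y + nmult n e + (x \<ominus> u)"
      using u_le by (rule add_right_mono)
    ultimately have "x \<le> nmult (Suc n) ?y" by (simp add: ac_simps)
    then have "?y = y" using min minus_le[OF top top] by blast
    \<comment> \<open>As \<open>e \<le> y\<close>, subtracting \<open>e\<close> is reversible, so
      \<open>?y = y\<close> forces \<open>e = 0\<close>.\<close>
    moreover have "e + ?y = y" using e minus_le[OF top top, of y] unfolding d_def
      by (intro plus_minus_le top) (meson order_trans)
    moreover have "(e + ?y) \<ominus> ?y = e"
      using lam_antimono[OF minus_le_lam[OF top top, of y e]] lam_le lam_lam top
      by (intro plus_minus_cancel minus_le_lam) auto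
    ultimately have "e = 0" using minus_self[OF top, of y] by simp
    then show False using e by simp
  qed
  then have y_eq: "y = x \<ominus> u"
    using plus_minus_le[OF le top] by (simp add: d_def)
  \<comment> \<open>Since \<open>u \<ominus> x\<close> is below \<open>u = nmult n y\<close> but
    disjoint from \<open>y\<close>, the copies of \<open>y\<close> can be stripped off one by one,
    which leaves \<open>u \<ominus> x = 0\<close>.\<close>
  have "inf (u \<ominus> x) y = 0" unfolding y_eq by (rule inf_minus_minus[OF top top])
  then have disj: "u \<ominus> x \<le> nmult m y \<Longrightarrow> u \<ominus> x \<le> 0" for m
    by (induction m) (auto dest: le_plus_disjoint[OF top top top])
  have "u \<ominus> x \<le> 0" using disj[of n] minus_le[OF top top, of u x] by (simp add: u_def)
  then have "u \<le> x" using minus_le_iff[OF top top top, of u x 0] by simp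
  then have "u + y = x"
    unfolding y_eq by (rule plus_minus_le[OF _ top])
  moreover have "y \<le> lam b u"
    unfolding y_eq by (rule minus_le_lam[OF top top])
  ultimately show ?thesis
    by (intro exI[of _ y]) (simp add: odot_eq_0_iff[OF top top] u_def)
qed

end

section \<open>Divisibility of strict locally complete algebras, and the equivalence\<close>

lemma strict_imp_divisible:
  fixes r :: "'a::emv_algebra \<Rightarrow> 'a"
  assumes complete: "locally_complete TYPE('a)" and strict: "strict_square_root r"
  shows "divisible TYPE('a)"
proof -
  obtain t :: 'a where t: "idempotent t" "\<And>x. x \<le> t" "lam t (r 0) = r 0"
    by (rule strict_imp_top[OF strict]) blast
  interpret emv_top t by unfold_locales (fact t)+
  obtain a where "t \<le> a"
      "Complete_Lattice.complete_lattice \<lparr>carrier = {0..a}, eq = (=), le = (\<le>)\<rparr>"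
    using complete unfolding locally_complete_def by blast
  \<comment> \<open>Local completeness at the top element \<open>t\<close> is completeness of
    \<open>[0,t]\<close> itself.\<close>
  moreover from this have "a = t" using t(2)[of a] by simp
  ultimately have *: "Complete_Lattice.complete_lattice \<lparr>carrier = {0..t}, eq = (=), le = (\<le>)\<rparr>"
    by simp
  have r: "square_root r" using strict by (simp add: strict_square_root_def)
  show ?thesis
    unfolding divisible_def
  proof (intro allI impI)
    fix x :: 'a and n :: nat
    assume "1 \<le> n"
    then obtain m where "n = Suc m" by (cases n) auto
    then show "\<exists>y. nmult n y = x \<and> nmult (n - 1) y \<odot> y = 0"
      using divisor[OF r t(3) *, of m x] by simp
  qed
qed

theorem theorem5p7:
  fixes r :: "'a::emv_algebra \<Rightarrow> 'a"
  assumes "locally_complete TYPE('a)"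
    and "square_root r"
  shows "(divisible TYPE('a) \<longleftrightarrow> strict_square_root r) \<and>
    (divisible TYPE('a) \<longrightarrow> (\<exists>t::'a. \<forall>x. x \<le> t))"
  using assms divisible_imp_strict strict_imp_divisible strict_imp_top by metis

end
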